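(* Let $U \subset \mathbb{A}^3_{\mathbb{Q}}$ be the affine cubic surface with coordinates $(y,u,z)$ defined by $2uyz = y^2 - 3u^2 - 1$. Assume the Browning–Wilsch conjecture holds for $U$, namely that $N_U^\circ(B) \ll_U (\log B)^{\rho_U + b}$ as $B \to \infty$ (for this surface $\rho_U = 2$ and $b = 2$, so the assumption reads $N_U^\circ(B) \ll (\log B)^4$). Let $d(z) = z^2 + 3$ and let $\epsilon > 0$. Then for almost all $z \in \mathbb{Z}_{>0}$ with $3 \nmid z$ and $d(z)$ square-free (i.e. for all such $z$ outside a set of density zero) we have $$\log \varepsilon_{d(z)} \gg d(z)^{\frac18 - \epsilon}.$$
   Context: For a non-square integer $d \geq 2$, $\varepsilon_d = t_1 + u_1\sqrt{d}$ denotes the fundamental solution of the Pell equation $t^2 - du^2 = 1$, i.e. the solution with $t_1,u_1 \geq 1$ such that all integer solutions are $\pm\varepsilon_d^n$, $n \in \mathbb{Z}$. An $\mathbb{A}^1$-curve on $U$ defined over $\mathbb{Z}$ is the image of a non-constant polynomial map $s \mapsto (y(s),u(s),z(s))$ with $y,u,z \in \mathbb{Z}[s]$ whose image lies in $U$. $U(\mathbb{Z})^\circ$ is the set of integer points of $U$ not lying on any $\mathbb{A}^1$-curve defined over $\mathbb{Z}$, and $N_U^\circ(B) = \#\{(y,u,z) \in U(\mathbb{Z})^\circ : \max(|y|,|u|,|z|) \leq B\}$. In the Browning–Wilsch conjecture, $X$ is the closure of $U$ in $\mathbb{P}^3_{\mathbb{Q}}$, $\tilde X \to X$ is a morphism from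 a smooth projective surface which is an isomorphism over $U$ and such that $\tilde D = \tilde X \setminus U$ is a strict normal crossings divisor with class $\omega_{\tilde X}^\vee$; $\rho_U$ is the Picard number of $U$ over $\mathbb{Q}$ and $b$ is the maximal number of components of $\tilde D(\mathbb{R})$ that share a real point. *)

theory Defs
  imports
    Complex_Main
    "HOL-Computational_Algebra.Polynomial"
    "HOL-Computational_Algebra.Squarefree"
    "HOL-Library.Landau_Symbols"
begin

(* The surface 2uyz = y^2 - 3u^2 - 1 as a functor of points, with coordinates ordered (y, u, z);
   it is used below over the integers and over the complex numbers. *)
definition surface_U :: "('a::comm_ring_1 \<times> 'a \<times> 'a) set" where
  "surface_U = {(y, u, z). 2 * u * y * z = y\<^sup>2 - 3 * u\<^sup>2 - 1}"

(* A curve is represented by its set of complex points: the parameter s ranges over all complex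
   numbers, so an integer point may lie on the curve without coming from an integer s. *)
definition is_A1_curve_over_Z :: "(complex \<times> complex \<times> complex) set \<Rightarrow> bool" where
  "is_A1_curve_over_Z C \<longleftrightarrow>
     (\<exists>p q r :: int poly.
        \<not> (degree p = 0 \<and> degree q = 0 \<and> degree r = 0) \<and>
        C = range (\<lambda>s. (poly (map_poly of_int p) s,
                        poly (map_poly of_int q) s,
                        poly (map_poly of_int r) s)) \<and>
        C \<subseteq> surface_U)"

definition U_circ :: "(int \<times> int \<times> int) set" where
  "U_circ = {(y, u, z) \<in> surface_U.
     \<not> (\<exists>C. is_A1_curve_over_Z C \<and> (of_int y, of_int u, of_int z) \<in> C)}"

definition N_U_circ :: "real \<Rightarrow> nat" where
  "N_U_circ B = card {(y, u, z) \<in> U_circ. real_of_int (Max {\<bar>y\<bar>, \<bar>u\<bar>, \<bar>z\<bar>}) \<le> B}"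

(* The exponent is rho_U + b, where rho_U = 2 is the Picard number of U over the rationals and
   b = 2 is the maximal number of components of the real boundary divisor sharing a real point. *)
definition browning_wilsch_U :: bool where
  "browning_wilsch_U \<longleftrightarrow> (\<lambda>B. real (N_U_circ B)) \<in> O[at_top](\<lambda>B. (ln B) ^ (2 + 2))"

definition is_fundamental_solution :: "nat \<Rightarrow> int \<Rightarrow> int \<Rightarrow> bool" where
  "is_fundamental_solution d t u \<longleftrightarrow>
     t \<ge> 1 \<and> u \<ge> 1 \<and> t\<^sup>2 - int d * u\<^sup>2 = 1 \<and>
     {of_int a + of_int b * sqrt (real d) | a b :: int. a\<^sup>2 - int d * b\<^sup>2 = 1} =
     (\<Union>n :: int. {(of_int t + of_int u * sqrt (real d)) powi n,
                  - ((of_int t + of_int u * sqrt (real d)) powi n)})"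

(* Meaningful only when d is not a perfect square, in which case the fundamental solution exists
   and is unique. *)
definition pell_eps :: "nat \<Rightarrow> real" where
  "pell_eps d = (THE e. \<exists>t u. is_fundamental_solution d t u \<and> e = of_int t + of_int u * sqrt (real d))"

(* Natural density within the positive integers. *)
definition density_zero :: "nat set \<Rightarrow> bool" where
  "density_zero E \<longleftrightarrow> (\<lambda>N. real (card (E \<inter> {1..N})) / real N) \<longlonglongrightarrow> 0"

definition d_of :: "nat \<Rightarrow> nat" where
  "d_of z = z\<^sup>2 + 3"

end

(* Substituting t = y - u z turns the equation of U into the Pell equation t^2 - (z^2 + 3) u^2 = 1,
   so the fundamental solution for d = z^2 + 3 gives the integer point (t + u z, u, z), of height at
   most epsilon_d.  Such a point lies on no A^1-curve when 3 does not divide z: a polynomial solution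
   of T^2 - (R^2 + 3) Q^2 = 1 with R nonconstant has the form
   T + Q sqrt(R^2 + 3) = a (R +- sqrt(R^2 + 3))^m with a constant, and as R + sqrt(R^2 + 3) has
   norm -3, specialising at an integer point with 3 not dividing z forces m = 0 and hence u = 0.
   If log epsilon_d < d^alpha with alpha < 1/8, then for z <= N these points have height at most
   exp((N^2 + 3)^alpha), and the conjecture bounds their number by O(N^(8 alpha)) = o(N). *)

theory Submission imports Defs "HOL-Analysis.Kronecker_Approximation_Theorem" "HOL-Real_Asymp.Real_Asymp" begin

section \<open>Square roots of square-free integers and coordinates in Z[sqrt d]\<close>

lemma sqrt_squarefree_irrational:
  assumes "squarefree d" "d > 1"
  shows "sqrt (real d) \<notin> \<rat>"
proof
  assume "sqrt (real d) \<in> \<rat>"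
  then obtain m n :: int where mn: "n > 0" "coprime m n" "sqrt (real d) = of_int m / of_int n"
    by (meson Rats_cases')
  have "real d * of_int n ^ 2 = of_int m ^ 2"
    using mn(1,3) by (metis (no_types, lifting) div_by_0 nonzero_divide_eq_eq of_int_0_eq_iff of_nat_0_le_iff
        order_less_irrefl power_divide real_sqrt_pow2 power_not_zero)
  then have "of_int (int d * n\<^sup>2) = (of_int (m\<^sup>2) :: real)" by simp
  then have eq: "int d * n\<^sup>2 = m\<^sup>2" by (simp only: of_int_eq_iff)
  then have "n dvd m\<^sup>2" by (metis dvd_triv_right dvd_mult power2_eq_square)
  then have "n dvd 1"
    using mn(2) by (metis coprime_commute coprime_dvd_mult_left_iff power2_eq_square coprime_absorb_left)
  with mn(1) have "n = 1" by simp
  with eq have "int d = int (nat \<bar>m\<bar> ^ 2)" by simp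
  then have d: "d = nat \<bar>m\<bar> ^ 2" by (simp only: of_nat_eq_iff)
  with assms(1) have "nat \<bar>m\<bar> dvd 1" by (auto simp: squarefree_def)
  with d assms(2) show False by simp
qed

lemma sqrt_combination_inj:
  assumes irr: "sqrt (real d) \<notin> \<rat>"
    and eq: "of_int a + of_int b * sqrt (real d) = of_int a' + of_int b' * sqrt (real d)"
  shows "a = a' \<and> b = b'"
proof -
  have "b = b'"
  proof (rule ccontr)
    assume "b \<noteq> b'"
    then have "sqrt (real d) = of_int (a' - a) / of_int (b - b')"
      using eq by (simp add: field_simps)
    also have "\<dots> \<in> \<rat>" by (intro Rats_divide Rats_of_int)
    finally show False using irr by simp
  qed
  with eq show ?thesis by simp
qed

section \<open>A nontrivial solution of the Pell equation by Diophantine approximation\<close>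

text \<open>Dirichlet's argument: the infinitely many approximations p/q of sqrt d with error below
  1/q^2 have norms p^2 - d q^2 in a bounded range. Two applications of the pigeonhole principle give
  two distinct pairs of the same norm \<open>k\<close> that are congruent modulo \<open>k\<close>,
  and their quotient is an integral element of norm 1.\<close>

lemma pell_nontrivial_solution:
  assumes irr: "sqrt (real d) \<notin> \<rat>"
  shows "\<exists>x y :: int. y \<noteq> 0 \<and> x\<^sup>2 - int d * y\<^sup>2 = 1"
proof -
  define w where "w = sqrt (real d)"
  have w0: "w \<ge> 0" and ww: "w * w = real d" by (simp_all add: w_def)
  define norm :: "int \<times> int \<Rightarrow> int" where "norm = (\<lambda>(p, q). p\<^sup>2 - int d * q\<^sup>2)"
  define S where "S = approx_set w"
  have inf: "infinite S"
    using irr rational_iff_finite_approx_set by (auto simp: S_def w_def)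
  have Spos: "q > 0" if "(p, q) \<in> S" for p q using that by (auto simp: S_def approx_set_def)
  define K where "K = \<lceil>2 * w + 1\<rceil>"
  have bound: "\<bar>norm x\<bar> \<le> K" if "x \<in> S" for x
  proof -
    obtain p q where x: "x = (p, q)" by force
    have q: "q > 0" "\<bar>w - of_int p / of_int q\<bar> < 1 / (of_int q)\<^sup>2"
      using that by (auto simp: x S_def approx_set_def)
    define \<delta> where "\<delta> = of_int p - w * of_int q"
    have q1: "real_of_int q \<ge> 1" using q(1) by simp
    have "\<bar>\<delta>\<bar> = of_int q * \<bar>w - of_int p / of_int q\<bar>"
      using q(1) by (simp add: \<delta>_def abs_if field_simps)
    also have "\<dots> < of_int q * (1 / (of_int q)\<^sup>2)"
      using q by (intro mult_strict_left_mono) auto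
    also have "\<dots> = 1 / of_int q" using q(1) by (simp add: power2_eq_square)
    finally have d1: "\<bar>\<delta>\<bar> < 1 / of_int q" .
    then have dq: "\<bar>\<delta>\<bar> * of_int q \<le> 1" using q(1) by (simp add: field_simps)
    have "1 / real_of_int q \<le> 1" using q1 by simp
    with d1 have dle: "\<bar>\<delta>\<bar> \<le> 1" by linarith
    \<comment> \<open>With p = \<open>\<delta>\<close> + w q, the factorization (p - w q)(p + w q)
      of the norm becomes \<open>\<delta>\<close>(\<open>\<delta>\<close> + 2 w q). The bounds
      |\<open>\<delta>\<close>| \<le> 1 and |\<open>\<delta>\<close>| q \<le> 1 then give 1 + 2 w,
      which is where \<open>K\<close> comes from.\<close>
    have "real_of_int (norm x) = \<delta> * \<delta> + 2 * w * (\<delta> * of_int q)"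
      by (simp add: x norm_def \<delta>_def power2_eq_square algebra_simps ww flip: ww)
    also have "\<bar>\<dots>\<bar> \<le> \<bar>\<delta>\<bar> * \<bar>\<delta>\<bar> + 2 * w * (\<bar>\<delta>\<bar> * of_int q)"
      using w0 q(1) by (intro order_trans[OF abs_triangle_ineq]) (simp add: abs_mult)
    also have "\<dots> \<le> 1 * 1 + 2 * w * 1"
      using w0 dq dle by (intro add_mono mult_mono mult_left_mono) auto
    finally have "\<bar>real_of_int (norm x)\<bar> \<le> 2 * w + 1" by simp
    then have "real_of_int \<bar>norm x\<bar> \<le> of_int K" unfolding K_def by linarith
    then show ?thesis by (simp only: of_int_le_iff)
  qed
  have "norm ` S \<subseteq> {-K..K}" using bound by force
  then have "finite (norm ` S)" using finite_subset by blast
  from pigeonhole_infinite[OF inf this] obtain x0 where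
    x0: "x0 \<in> S" "infinite {x \<in> S. norm x = norm x0}" by blast
  define k where "k = norm x0"
  define T where "T = {x \<in> S. norm x = k}"
  have k0: "k \<noteq> 0"
  proof
    assume "k = 0"
    obtain p q where x: "x0 = (p, q)" by force
    have q: "q > 0" using Spos x0(1) x by simp
    have "p\<^sup>2 = int d * q\<^sup>2" using \<open>k = 0\<close> by (simp add: k_def x norm_def)
    then have "real_of_int (p\<^sup>2) = real_of_int (int d * q\<^sup>2)" by simp
    then have "(of_int p)\<^sup>2 = (w * of_int q)\<^sup>2" by (simp add: w_def power_mult_distrib)
    then have "\<bar>of_int p\<bar> = \<bar>w * of_int q\<bar>" by (simp add: power2_eq_iff abs_eq_iff)
    then have "w = of_int \<bar>p\<bar> / of_int q" using q w0 by (simp add: field_simps abs_mult)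
    also have "\<dots> \<in> \<rat>" by (intro Rats_divide Rats_of_int)
    finally show False using irr by (simp add: w_def)
  qed
  have infT: "infinite T" using x0(2) by (simp add: T_def k_def)
  \<comment> \<open>The sign of \<open>k\<close> is not known, so the residues are confined to an
    interval symmetric about 0.\<close>
  define res where "res = (\<lambda>(p, q). (p mod k, q mod k))"
  have "res ` T \<subseteq> {-\<bar>k\<bar>..\<bar>k\<bar>} \<times> {-\<bar>k\<bar>..\<bar>k\<bar>}"
  proof -
    have "x mod k \<in> {-\<bar>k\<bar>..\<bar>k\<bar>}" for x
      using abs_mod_less[OF k0, of x] by auto
    then show ?thesis by (auto simp: res_def)
  qed
  then have "finite (res ` T)" by (rule finite_subset) auto
  from pigeonhole_infinite[OF infT this] obtain x1 where
    x1: "x1 \<in> T" "infinite {x \<in> T. res x = res x1}" by blast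
  have "infinite ({x \<in> T. res x = res x1} - {x1})" using x1(2) by simp
  then obtain x2 where x2: "x2 \<in> T" "res x2 = res x1" "x2 \<noteq> x1"
    using infinite_imp_nonempty by blast
  obtain p q p' q' where xx: "x1 = (p, q)" "x2 = (p', q')" by force
  have pq: "p * p - int d * (q * q) = k" "p' * p' - int d * (q' * q') = k" "q > 0" "q' > 0"
    using x1(1) x2(1) Spos by (auto simp: T_def norm_def xx power2_eq_square)
  obtain a b where ab: "p' = p + k * a" "q' = q + k * b"
  proof -
    have "k dvd p' - p" "k dvd q' - q" using x2(2) by (auto simp: res_def xx mod_eq_dvd_iff)
    then obtain a b where "p' - p = k * a" "q' - q = k * b" by (auto simp: dvd_def)
    then show thesis by (intro that[of a b]) simp_all
  qed
  \<comment> \<open>\<open>x\<close> and \<open>y\<close> are the coordinates of (p' + q' w)/(p + q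
    w) = (p' + q' w)(p - q w)/k. Writing p' and q' through \<open>a\<close> and \<open>b\<close>
    carries out the division by \<open>k\<close> and shows that the coordinates are
    integers.\<close>
  define x where "x = 1 + p * a - int d * (q * b)"
  define y where "y = p * b - q * a"
  have kx: "k * x = p * p' - int d * (q * q')" and ky: "k * y = p * q' - q * p'"
    unfolding x_def y_def ab by (subst pq(1)[symmetric], simp add: algebra_simps)+
  have "k * k * (x\<^sup>2 - int d * y\<^sup>2) = (k * x)\<^sup>2 - int d * (k * y)\<^sup>2"
    by (simp add: power2_eq_square algebra_simps)
  also have "\<dots> = (p * p - int d * (q * q)) * (p' * p' - int d * (q' * q'))"
    unfolding kx ky by (simp add: power2_eq_square algebra_simps)
  also have "\<dots> = k * k" using pq by simp
  finally have "x\<^sup>2 - int d * y\<^sup>2 = 1" using k0 by simp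
  \<comment> \<open>If \<open>y\<close> vanished, the two pairs would be proportional; equal nonzero
    norms and positive denominators would then make them equal.\<close>
  moreover have "y \<noteq> 0"
  proof
    assume "y = 0"
    with ky have e: "p * q' = q * p'" by simp
    have "k * (q' * q') = (p * q') * (p * q') - int d * (q * q') * (q * q')"
      by (subst pq(1)[symmetric]) (simp add: algebra_simps)
    also have "\<dots> = k * (q * q)"
      unfolding e by (subst pq(2)[symmetric]) (simp add: algebra_simps)
    finally have "q' * q' = q * q" using k0 by simp
    then have "q = q'" using pq(3,4) by (metis power2_eq_square power2_eq_iff_nonneg less_imp_le)
    with e pq(3) have "p = p'" by simp
    with \<open>q = q'\<close> x2(3) xx show False by simp
  qed
  ultimately show ?thesis by blast
qed

section \<open>The group of elements of norm 1\<close>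

text \<open>This is the left-hand set in \<open>is_fundamental_solution\<close>, named so that its
  group structure can be used.\<close>

definition pell_units :: "nat \<Rightarrow> real set" where
  "pell_units d = {of_int a + of_int b * sqrt (real d) | a b :: int. a\<^sup>2 - int d * b\<^sup>2 = 1}"

lemma pell_unitsI: "a\<^sup>2 - int d * b\<^sup>2 = 1 \<Longrightarrow> of_int a + of_int b * sqrt (real d) \<in> pell_units d"
  by (auto simp: pell_units_def)

lemma pell_units_mult:
  assumes "x \<in> pell_units d" "y \<in> pell_units d"
  shows "x * y \<in> pell_units d"
proof -
  obtain a b where x: "x = of_int a + of_int b * sqrt (real d)" "a\<^sup>2 - int d * b\<^sup>2 = 1"
    using assms(1) by (auto simp: pell_units_def)
  obtain a' b' where y: "y = of_int a' + of_int b' * sqrt (real d)" "a'\<^sup>2 - int d * b'\<^sup>2 = 1"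
    using assms(2) by (auto simp: pell_units_def)
  have "(a * a' + int d * (b * b'))\<^sup>2 - int d * (a * b' + b * a')\<^sup>2
      = (a\<^sup>2 - int d * b\<^sup>2) * (a'\<^sup>2 - int d * b'\<^sup>2)"
    by (simp add: power2_eq_square algebra_simps)
  then have "of_int (a * a' + int d * (b * b')) + of_int (a * b' + b * a') * sqrt (real d) \<in> pell_units d"
    using x y by (intro pell_unitsI) simp
  also have "of_int (a * a' + int d * (b * b')) + of_int (a * b' + b * a') * sqrt (real d) = x * y"
  proof -
    have "sqrt (real d) * sqrt (real d) = real d" by simp
    then show ?thesis unfolding x y by (simp add: algebra_simps)
  qed
  finally show ?thesis .
qed

lemma pell_units_inverse:
  assumes "x \<in> pell_units d"
  shows "inverse x \<in> pell_units d"
proof -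
  obtain a b where x: "x = of_int a + of_int b * sqrt (real d)" "a\<^sup>2 - int d * b\<^sup>2 = 1"
    using assms by (auto simp: pell_units_def)
  have "x * (of_int a + of_int (-b) * sqrt (real d)) = of_int (a\<^sup>2 - int d * b\<^sup>2)"
    unfolding x(1) by (simp add: algebra_simps power2_eq_square)
  then have "inverse x = of_int a + of_int (-b) * sqrt (real d)"
    using x(2) by (intro inverse_unique) simp
  then show ?thesis using x(2) by (simp only:) (rule pell_unitsI, simp)
qed

lemma pell_units_uminus:
  assumes "x \<in> pell_units d"
  shows "- x \<in> pell_units d"
proof -
  obtain a b where x: "x = of_int a + of_int b * sqrt (real d)" "a\<^sup>2 - int d * b\<^sup>2 = 1"
    using assms by (auto simp: pell_units_def)
  have "of_int (-a) + of_int (-b) * sqrt (real d) \<in> pell_units d"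
    using x(2) by (intro pell_unitsI) simp
  then show ?thesis by (simp add: x(1))
qed

lemma pell_units_one: "1 \<in> pell_units d"
  using pell_unitsI[of 1 d 0] by simp

lemma pell_units_power: "x \<in> pell_units d \<Longrightarrow> x ^ n \<in> pell_units d"
  by (induction n) (auto intro: pell_units_one pell_units_mult)

lemma pell_units_powi: "x \<in> pell_units d \<Longrightarrow> x powi n \<in> pell_units d"
  by (auto simp: power_int_def intro: pell_units_power pell_units_inverse)

text \<open>The conjugate of a unit v > 1 of norm 1 is 1/v, which lies strictly between 0 and 1.
  Hence v + 1/v and v - 1/v are positive, and these are twice the rational and the irrational
  part.\<close>

lemma pell_units_greater_one:
  assumes x: "of_int a + of_int b * sqrt (real d) > 1" and n: "a\<^sup>2 - int d * b\<^sup>2 = 1"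
  shows "a \<ge> 1" "b \<ge> 1"
proof -
  define v where "v = of_int a + of_int b * sqrt (real d)"
  define v' where "v' = of_int a - of_int b * sqrt (real d)"
  have "v * v' = of_int (a\<^sup>2 - int d * b\<^sup>2)"
    by (simp add: v_def v'_def algebra_simps power2_eq_square)
  then have p: "v * v' = 1" using n by simp
  have v1: "v > 1" using x by (simp add: v_def)
  have v': "v' = 1 / v" using p v1 by (simp add: field_simps)
  have pos: "v' > 0" "v' < 1" using v1 by (simp_all add: v')
  have "2 * of_int a = v + v'" by (simp add: v_def v'_def)
  with v1 pos have "real_of_int a > 0" by linarith
  then show "a \<ge> 1" by simp
  have "2 * (of_int b * sqrt (real d)) = v - v'" by (simp add: v_def v'_def)
  with v1 pos have "of_int b * sqrt (real d) > 0" by linarith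
  then have "real_of_int b > 0" by (simp add: zero_less_mult_iff)
  then show "b \<ge> 1" by simp
qed

section \<open>Existence and uniqueness of the fundamental solution\<close>

text \<open>The positive solution with the least second coordinate gives the least unit
  \<open>e\<close> > 1. Dividing a positive unit by a suitable power of \<open>e\<close> leaves a
  unit in [1, e), which must be 1; negative units follow by a change of sign.\<close>

lemma fundamental_solution_exists:
  assumes irr: "sqrt (real d) \<notin> \<rat>"
  shows "\<exists>t u. is_fundamental_solution d t u"
proof -
  define P where "P = (\<lambda>n. \<exists>t. t \<ge> 1 \<and> n \<ge> 1 \<and> t\<^sup>2 - int d * (int n)\<^sup>2 = 1)"
  obtain x y where xy: "y \<noteq> 0" "x\<^sup>2 - int d * y\<^sup>2 = 1"
    using pell_nontrivial_solution[OF irr] by blast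
  have "x \<noteq> 0" using xy by (auto simp: power2_eq_square) (smt (verit) mult_nonneg_nonneg zero_le_square of_nat_0_le_iff)
  with xy have "P (nat \<bar>y\<bar>)" by (auto simp: P_def intro!: exI[of _ "\<bar>x\<bar>"])
  define n where "n = (LEAST n. P n)"
  have "P n" unfolding n_def using \<open>P _\<close> by (rule LeastI)
  then obtain t where t: "t \<ge> 1" "n \<ge> 1" "t\<^sup>2 - int d * (int n)\<^sup>2 = 1" by (auto simp: P_def)
  define e where "e = of_int t + of_int (int n) * sqrt (real d)"
  have "sqrt (real d) \<noteq> 0" using irr by (metis Rats_0)
  then have w: "sqrt (real d) > 0" by simp
  have e1: "e > 1"
  proof -
    have "of_int (int n) * sqrt (real d) > 0" using t w by simp
    moreover have "real_of_int t \<ge> 1" using t by simp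
    ultimately show ?thesis unfolding e_def by linarith
  qed
  have eU: "e \<in> pell_units d" unfolding e_def using t by (intro pell_unitsI)
  \<comment> \<open>By the Pell equation the first coordinate increases with the second, so
    minimality of \<open>n\<close> bounds both coordinates of \<open>v\<close> from below.\<close>
  have least: "v \<ge> e" if vU: "v \<in> pell_units d" and v1: "v > 1" for v
  proof -
    obtain a b where v: "v = of_int a + of_int b * sqrt (real d)" and ab: "a\<^sup>2 - int d * b\<^sup>2 = 1"
      using vU by (auto simp: pell_units_def)
    have ab1: "a \<ge> 1" "b \<ge> 1" using pell_units_greater_one v1 ab unfolding v by blast+
    then have "P (nat b)" using ab by (auto simp: P_def)
    then have "n \<le> nat b" unfolding n_def by (rule Least_le)
    then have nb: "int n \<le> b" using ab1 by linarith
    have "t\<^sup>2 = 1 + int d * (int n)\<^sup>2" "a\<^sup>2 = 1 + int d * b\<^sup>2" using t ab by simp_all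
    moreover have "int d * (int n)\<^sup>2 \<le> int d * b\<^sup>2" using nb by (intro mult_left_mono power_mono) auto
    ultimately have "t\<^sup>2 \<le> a\<^sup>2" by simp
    then have "t \<le> a" by (rule power2_le_imp_le) (use ab1 in simp)
    then have "real_of_int t \<le> of_int a" by simp
    moreover have "of_int (int n) * sqrt (real d) \<le> of_int b * sqrt (real d)"
      using nb by (intro mult_right_mono) simp_all
    ultimately show ?thesis unfolding v e_def by (rule add_mono)
  qed
  have gen: "\<exists>k. v = e powi k" if "v \<in> pell_units d" "v > 0" for v
  proof -
    \<comment> \<open>The floor of the logarithm is the exponent with e^k \<le> v < e^(k+1).\<close>
    define k where "k = \<lfloor>log e v\<rfloor>"
    define r where "r = v * e powi (-k)"
    have rU: "r \<in> pell_units d" unfolding r_def using that eU by (intro pell_units_mult pell_units_powi)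
    have le: "e powr of_int k \<le> v" "v < e powr (of_int k + 1)"
    proof -
      have "of_int k \<le> log e v" "log e v < of_int k + 1" by (simp_all add: k_def)
      then show "e powr of_int k \<le> v" "v < e powr (of_int k + 1)"
        using e1 that(2) by (simp_all add: le_log_iff log_less_iff)
    qed
    have pk: "e powr of_int k = e powi k" using e1 by (simp add: powr_real_of_int')
    have ek: "e powi k > 0" using e1 by simp
    have r: "r = v / e powi k" by (simp add: r_def power_int_minus field_simps)
    have "r \<ge> 1" "r < e" using le e1 ek unfolding r by (simp_all add: pk powr_add field_simps)
    with least[OF rU] have "r = 1" by linarith
    then have "v = e powi k" using ek unfolding r by simp
    then show ?thesis ..
  qed
  have "pell_units d = (\<Union>k :: int. {e powi k, - (e powi k)})"
  proof (intro equalityI subsetI)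
    fix v assume v: "v \<in> pell_units d"
    have "v \<noteq> 0"
    proof
      assume "v = 0"
      then obtain a b :: int where "of_int a + of_int b * sqrt (real d) = of_int 0 + of_int 0 * sqrt (real d)" "a\<^sup>2 - int d * b\<^sup>2 = 1"
        using v by (auto simp: pell_units_def)
      with sqrt_combination_inj[OF irr] show False by fastforce
    qed
    then consider "v > 0" | "- v > 0" by linarith
    then show "v \<in> (\<Union>k :: int. {e powi k, - (e powi k)})"
    proof cases
      case 1
      then show ?thesis using gen[OF v] by auto
    next
      case 2
      then obtain k where "- v = e powi k" using gen[OF pell_units_uminus[OF v]] by auto
      then have "v = - (e powi k)" by linarith
      then show ?thesis by auto
    qed
  next
    fix v assume "v \<in> (\<Union>k :: int. {e powi k, - (e powi k)})"
    then show "v \<in> pell_units d" using eU by (auto intro: pell_units_powi pell_units_uminus)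
  qed
  then have "is_fundamental_solution d t (int n)"
    using t by (simp add: is_fundamental_solution_def pell_units_def e_def)
  then show ?thesis by blast
qed

lemma fundamental_solution_greater_one:
  assumes "is_fundamental_solution d t u" "sqrt (real d) \<notin> \<rat>"
  shows "of_int t + of_int u * sqrt (real d) > 1"
proof -
  have "sqrt (real d) \<noteq> 0" using assms(2) by (metis Rats_0)
  moreover have "real_of_int t \<ge> 1" "real_of_int u > 0" using assms(1) by (auto simp: is_fundamental_solution_def)
  ultimately show ?thesis by (smt (verit) mult_pos_pos real_sqrt_ge_0_iff of_nat_0_le_iff)
qed

text \<open>The second unit is a power of the first, and the exponent is at least 1 because both
  exceed 1. Used in both directions, this yields the uniqueness that the description operator in
  \<open>pell_eps\<close> requires.\<close>

lemma fundamental_solution_le: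
  assumes irr: "sqrt (real d) \<notin> \<rat>"
    and f: "is_fundamental_solution d t u" and g: "is_fundamental_solution d t' u'"
  shows "of_int t + of_int u * sqrt (real d) \<le> of_int t' + of_int u' * sqrt (real d)"
proof -
  define e where "e = of_int t + of_int u * sqrt (real d)"
  define e' where "e' = of_int t' + of_int u' * sqrt (real d)"
  have e: "e > 1" "e' > 1" using fundamental_solution_greater_one f g irr by (auto simp: e_def e'_def)
  have "e' \<in> pell_units d" using g unfolding e'_def by (intro pell_unitsI) (auto simp: is_fundamental_solution_def)
  also have "pell_units d = (\<Union>k :: int. {e powi k, - (e powi k)})"
    using f by (simp add: is_fundamental_solution_def pell_units_def e_def)
  finally obtain k where "e' = e powi k \<or> e' = - (e powi k)" by auto
  moreover have "e powi k > 0" using e by simp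
  ultimately have k: "e' = e powi k" using e by linarith
  have "k \<ge> 1"
  proof (rule ccontr)
    assume "\<not> k \<ge> 1"
    then have "e powi k \<le> e powi 0" using e by (intro power_int_increasing) auto
    with k e show False by simp
  qed
  then have "e powi 1 \<le> e powi k" using e by (intro power_int_increasing) auto
  then show ?thesis using k by (simp add: e_def e'_def)
qed

lemma pell_eps_eq:
  assumes irr: "sqrt (real d) \<notin> \<rat>"
  obtains t u where "is_fundamental_solution d t u" "pell_eps d = of_int t + of_int u * sqrt (real d)"
proof -
  obtain t u where f: "is_fundamental_solution d t u" using fundamental_solution_exists[OF irr] by blast
  have "pell_eps d = of_int t + of_int u * sqrt (real d)"
    unfolding pell_eps_def
  proof (rule the_equality)
    fix e assume "\<exists>t u. is_fundamental_solution d t u \<and> e = of_int t + of_int u * sqrt (real d)"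
    then show "e = of_int t + of_int u * sqrt (real d)"
      using fundamental_solution_le[OF irr] f by (metis order_antisym)
  qed (use f in blast)
  with f show ?thesis by (rule that)
qed

section \<open>The Pell equation for r^2 + 3 over polynomials\<close>

text \<open>The coefficients of \<open>(z + \<surd>(z\<^sup>2 + 3)) ^ m\<close>, an element of norm \<open>(-3) ^ m\<close>.\<close>

fun norm3_pow :: "'a::comm_ring_1 \<Rightarrow> nat \<Rightarrow> 'a \<times> 'a" where
  "norm3_pow z 0 = (1, 0)"
| "norm3_pow z (Suc m) =
     (z * fst (norm3_pow z m) + (z\<^sup>2 + 3) * snd (norm3_pow z m),
      fst (norm3_pow z m) + z * snd (norm3_pow z m))"

lemma norm3_pow_norm:
  "(fst (norm3_pow z m))\<^sup>2 - (z\<^sup>2 + 3) * (snd (norm3_pow z m))\<^sup>2 = (-3) ^ m"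
proof (induction m)
  case (Suc m)
  have "(fst (norm3_pow z (Suc m)))\<^sup>2 - (z\<^sup>2 + 3) * (snd (norm3_pow z (Suc m)))\<^sup>2
      = (-3) * ((fst (norm3_pow z m))\<^sup>2 - (z\<^sup>2 + 3) * (snd (norm3_pow z m))\<^sup>2)"
    by (simp add: algebra_simps power2_eq_square)
  then show ?case by (simp only: Suc.IH power_Suc)
qed simp

lemma norm3_pow_of_int: "norm3_pow (of_int z) m = map_prod of_int of_int (norm3_pow z m)"
  by (induction m) simp_all

lemma poly_norm3_pow:
  "poly (fst (norm3_pow r m)) x = fst (norm3_pow (poly r x) m)"
  "poly (snd (norm3_pow r m)) x = snd (norm3_pow (poly r x) m)"
  by (induction m) simp_all

text \<open>Write (P, Q) for the coefficients. Modulo 3 the number z^2 + 3 is z^2, so from the first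
  power on P is congruent to z Q, and each further factor turns Q into 2 z Q, which stays nonzero
  modulo 3.\<close>

lemma fst_norm3_pow_not_dvd_3:
  fixes z :: int
  assumes "\<not> 3 dvd z"
  shows "\<not> 3 dvd fst (norm3_pow z m)"
proof (cases m)
  case (Suc k)
  have "3 dvd fst (norm3_pow z (Suc k)) - z * snd (norm3_pow z (Suc k)) \<and> \<not> 3 dvd snd (norm3_pow z (Suc k))"
  proof (induction k)
    case (Suc k)
    define P Q where "P = fst (norm3_pow z (Suc k))" and "Q = snd (norm3_pow z (Suc k))"
    have PQ: "fst (norm3_pow z (Suc (Suc k))) = z * P + (z\<^sup>2 + 3) * Q" "snd (norm3_pow z (Suc (Suc k))) = P + z * Q"
      by (simp_all only: norm3_pow.simps(2)[of z "Suc k"] P_def Q_def fst_conv snd_conv)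
    have IH: "3 dvd P - z * Q" "\<not> 3 dvd Q" using Suc.IH unfolding P_def Q_def by blast+
    have "(z * P + (z\<^sup>2 + 3) * Q) - z * (P + z * Q) = 3 * Q" by (simp add: algebra_simps power2_eq_square)
    moreover have "\<not> 3 dvd P + z * Q"
    proof
      assume "3 dvd P + z * Q"
      then have "3 dvd (P + z * Q) - (P - z * Q)" using IH(1) by (rule dvd_diff)
      then have "3 dvd 2 * (z * Q)" by (simp add: algebra_simps)
      then have "3 dvd z * Q" by presburger
      moreover have "prime (3 :: int)" by simp
      ultimately show False using IH(2) assms by (simp add: prime_dvd_mult_iff)
    qed
    ultimately show ?case unfolding PQ by simp
  qed simp
  moreover have "prime (3 :: int)" by simp
  ultimately show ?thesis using assms Suc by (metis dvd_diff_commute dvd_diff_right_iff prime_dvd_mult_iff dvd_minus_iff zdvd_zdiffD)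
qed simp

text \<open>Multiplying \<open>T + U\<surd>(r\<^sup>2 + 3)\<close> by \<open>r - \<surd>(r\<^sup>2 + 3)\<close> or by its conjugate, both of norm \<open>-3\<close>,
  lowers the degree of \<open>U\<close>.\<close>

lemma pell_descent_degree:
  fixes T U r :: "'a::field_char_0 poly"
  assumes eq: "T\<^sup>2 - (r\<^sup>2 + 3) * U\<^sup>2 = [:c:]" and r: "degree r > 0" and U: "U \<noteq> 0"
  shows "\<exists>s. (s = 1 \<or> s = -1) \<and> (T - smult s (r * U) = 0 \<or> degree (T - smult s (r * U)) < degree U)"
proof -
  \<comment> \<open>The product c + 3 U^2 has degree at most 2 deg U, so when one factor has degree
    at least deg r + deg U, only deg U - deg r remains for the other.\<close>
  have small: "A = 0 \<or> degree A < degree U"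
    if AB: "A * B = [:c:] + 3 * U\<^sup>2" and B: "degree B \<ge> degree r + degree U" for A B :: "'a poly"
  proof (cases "A = 0")
    case False
    have "B \<noteq> 0" using B r by auto
    have "degree A + degree B = degree ([:c:] + 3 * U\<^sup>2)"
      using False \<open>B \<noteq> 0\<close> by (simp add: AB[symmetric] degree_mult_eq)
    also have "\<dots> \<le> 2 * degree U"
    proof (rule degree_add_le)
      have "degree (3 * U\<^sup>2) \<le> degree (3 :: 'a poly) + degree (U\<^sup>2)" by (rule degree_mult_le)
      then show "degree (3 * U\<^sup>2) \<le> 2 * degree U" using U by (simp add: degree_power_eq)
    qed simp
    finally show ?thesis using B r by linarith
  qed simp
  define A B where "A = T - r * U" and "B = T + r * U"
  have AB: "A * B = [:c:] + 3 * U\<^sup>2"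
    unfolding eq[symmetric] A_def B_def by (simp add: algebra_simps power2_eq_square)
  \<comment> \<open>The factors T - r U and T + r U differ by 2 r U, of degree deg r + deg U in
    characteristic 0. Hence one of them has at least that degree, and the other is the small
    one.\<close>
  have "degree (smult 2 (r * U)) = degree r + degree U" 
  proof -
    have "r \<noteq> 0" using r by auto
    with U show ?thesis by (simp add: degree_mult_eq)
  qed
  moreover have "smult 2 (r * U) = B - A"
    using smult_add_left[of 1 1 "r * U"] by (simp add: A_def B_def)
  ultimately have "degree r + degree U \<le> max (degree B) (degree A)"
    using degree_diff_le_max[of B A] by simp
  then consider "degree r + degree U \<le> degree B" | "degree r + degree U \<le> degree A" by linarith
  then show ?thesis
  proof cases
    case 1
    with small[OF AB] show ?thesis by (intro exI[of _ 1]) (simp add: A_def)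
  next
    case 2
    from AB have "B * A = [:c:] + 3 * U\<^sup>2" by (simp add: mult.commute)
    with small 2 show ?thesis by (intro exI[of _ "-1"]) (simp add: B_def)
  qed
qed

text \<open>With S = sqrt(r^2 + 3), the conclusion reads T + U S = a (r + \<sigma> S)^m. The descent
  ends at U = 0 with T constant, and undoing one descent step multiplies by r + S or r - S up to a
  constant.\<close>

lemma polynomial_pell_solutions:
  fixes T U r :: "'a::field_char_0 poly"
  assumes "T\<^sup>2 - (r\<^sup>2 + 3) * U\<^sup>2 = [:c:]" and r: "degree r > 0"
  shows "\<exists>m a \<sigma>. (\<sigma> = 1 \<or> \<sigma> = -1) \<and> T = smult a (fst (norm3_pow r m)) \<and>
           U = smult (\<sigma> * a) (snd (norm3_pow r m))"
  using assms(1)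
\<comment> \<open>The zero polynomial also has degree 0; shifting the degree of nonzero
  \<open>U\<close> by one lets the descent pass from a nonzero constant \<open>U\<close> to
  \<open>U = 0\<close>.\<close>
proof (induction "if U = 0 then 0 else Suc (degree U)" arbitrary: T U c rule: less_induct)
  case less
  show ?case
  proof (cases "U = 0")
    case True
    with less.prems have "T\<^sup>2 = [:c:]" by simp
    then have "degree (T\<^sup>2) = 0" by simp
    then have "degree T = 0" by (simp add: power2_eq_square degree_mult_eq_0)
      (metis degree_0)
    then obtain a where "T = [:a:]" by (rule degree_eq_zeroE)
    with True show ?thesis by (intro exI[of _ 0] exI[of _ a] exI[of _ 1]) (simp add: one_pCons)
  next
    case False
    obtain s where s: "s = 1 \<or> s = -1"
      "T - smult s (r * U) = 0 \<or> degree (T - smult s (r * U)) < degree U"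
      using pell_descent_degree[OF less.prems r False] by blast
    \<comment> \<open>T' + U' S = (T + U S)(S - s r) with S = sqrt(r^2 + 3); the last factor has
      norm -3.\<close>
    define U' where "U' = T - smult s (r * U)"
    define T' where "T' = (r\<^sup>2 + 3) * U - smult s (r * T)"
    have ss: "smult s (smult s p) = p" for p :: "'a poly" using s(1) by auto
    have "T'\<^sup>2 - (r\<^sup>2 + 3) * U'\<^sup>2 = - 3 * (T\<^sup>2 - (r\<^sup>2 + 3) * U\<^sup>2)"
      using s(1) unfolding T'_def U'_def by (elim disjE) (simp_all add: algebra_simps power2_eq_square)
    also have "\<dots> = [:-3 * c:]" unfolding less.prems by (simp add: numeral_poly)
    finally have "T'\<^sup>2 - (r\<^sup>2 + 3) * U'\<^sup>2 = [:-3 * c:]" .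
    moreover have "(if U' = 0 then 0 else Suc (degree U')) < (if U = 0 then 0 else Suc (degree U))"
      using s(2) False by (auto simp: U'_def)
    ultimately obtain m a \<sigma> where IH: "\<sigma> = 1 \<or> \<sigma> = -1"
      "T' = smult a (fst (norm3_pow r m))" "U' = smult (\<sigma> * a) (snd (norm3_pow r m))"
      using less.hyps by blast
    \<comment> \<open>Multiplication by S + s r inverts the descent step up to a factor 3, since (S
      - s r)(S + s r) = 3.\<close>
    have T3: "3 * T = smult s (r * T') + (r\<^sup>2 + 3) * U'" and U3: "3 * U = T' + smult s (r * U')"
      using s(1) unfolding T'_def U'_def by (auto simp: algebra_simps power2_eq_square)
    have third: "p = smult (b / 3) q" if "3 * p = smult b q" for p q :: "'a poly" and b
    proof -
      have "smult 3 p = smult b q" using that by (simp add: numeral_poly)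
      then have "smult (1/3) (smult 3 p) = smult (1/3) (smult b q)" by simp
      then show ?thesis by simp
    qed
    show ?thesis
    \<comment> \<open>The factor S + s r equals s (r + s S). If \<sigma> = s it raises the exponent
      by one, and for m = 0 the sign \<sigma> is arbitrary. If \<sigma> = -s, it cancels against one
      factor r - s S, with product -3, and the exponent drops by one.\<close>
    proof (cases "\<sigma> = s \<or> m = 0")
      case True
      then have U': "U' = smult (s * a) (snd (norm3_pow r m))" using IH(3) by auto
      have "3 * T = smult (s * a) (fst (norm3_pow r (Suc m)))"
        unfolding T3 IH(2) U' by (simp add: smult_add_right algebra_simps)
      moreover have "3 * U = smult (s * (s * a)) (snd (norm3_pow r (Suc m)))"
        using s(1) unfolding U3 IH(2) U' by (auto simp: smult_add_right algebra_simps)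
      ultimately have "T = smult (s * a / 3) (fst (norm3_pow r (Suc m)))"
        "U = smult (s * (s * a) / 3) (snd (norm3_pow r (Suc m)))"
        by (blast intro: third)+
      then have "(s = 1 \<or> s = -1) \<and> T = smult (s * a / 3) (fst (norm3_pow r (Suc m))) \<and>
          U = smult (s * (s * a / 3)) (snd (norm3_pow r (Suc m)))"
        using s(1) by (simp only: times_divide_eq_right)
      then show ?thesis by blast
    next
      case F: False
      then have \<sigma>: "\<sigma> = - s" using IH(1) s(1) by auto
      from F obtain k where k: "m = Suc k" by (cases m) auto
      have "3 * T = smult (3 * (- s * a)) (fst (norm3_pow r k))"
        unfolding T3 IH(2,3) \<sigma> k by (simp add: smult_add_right smult_diff_right algebra_simps power2_eq_square numeral_poly)
      moreover have "3 * U = smult (3 * ((- s) * (- s * a))) (snd (norm3_pow r k))"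
        using s(1) unfolding U3 IH(2,3) \<sigma> k
        by (elim disjE; simp add: smult_add_right smult_diff_right algebra_simps power2_eq_square numeral_poly)
      ultimately have "T = smult (3 * (- s * a) / 3) (fst (norm3_pow r k))"
        "U = smult (3 * ((- s) * (- s * a)) / 3) (snd (norm3_pow r k))"
        by (blast intro: third)+
      moreover have "3 * x / 3 = x" for x :: 'a by simp
      ultimately have "(- s = 1 \<or> - s = -1) \<and> T = smult (- s * a) (fst (norm3_pow r k)) \<and>
          U = smult ((- s) * (- s * a)) (snd (norm3_pow r k))"
        using s(1) by auto
      then show ?thesis by blast
    qed
  qed
qed

section \<open>Integer points of the surface and A^1-curves\<close>

lemma surface_U_iff_pell:
  "(y, u, z) \<in> surface_U \<longleftrightarrow> (y - u * z)\<^sup>2 - (z\<^sup>2 + 3) * u\<^sup>2 = 1"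
  by (auto simp: surface_U_def power2_eq_square algebra_simps)

text \<open>The condition \<open>u \<noteq> 0\<close> excludes the lines y = 1, u = 0 and y = -1, u
  = 0, which are A^1-curves meeting every value of z. The classification of polynomial solutions
  covers curves along which z varies; for constant z there is no curve at all.\<close>

lemma mem_A1_curve_imp_dvd_3:
  fixes y u z :: int
  assumes curve: "is_A1_curve_over_Z C" and mem: "(of_int y, of_int u, of_int z) \<in> C"
    and u: "u \<noteq> 0"
  shows "3 dvd z"
proof (rule ccontr)
  assume z3: "\<not> 3 dvd z"
  obtain p0 q0 r0 :: "int poly" where
    nonconst: "\<not> (degree p0 = 0 \<and> degree q0 = 0 \<and> degree r0 = 0)"
    and C: "C = range (\<lambda>s. (poly (map_poly of_int p0) s, poly (map_poly of_int q0) s,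
                          poly (map_poly of_int r0) s))"
    and sub: "C \<subseteq> surface_U"
    using curve unfolding is_A1_curve_over_Z_def by blast
  define p q r :: "complex poly" where
    "p = map_poly of_int p0" and "q = map_poly of_int q0" and "r = map_poly of_int r0"
  have deg: "degree p = degree p0" "degree q = degree q0" "degree r = degree r0"
    by (simp_all add: p_def q_def r_def degree_map_poly)
  obtain s where s: "poly p s = of_int y" "poly q s = of_int u" "poly r s = of_int z"
    using mem unfolding C p_def q_def r_def by auto
  define T where "T = p - q * r"
  have eq: "T\<^sup>2 - (r\<^sup>2 + 3) * q\<^sup>2 = [:1:]"
  proof (rule poly_ext)
    fix x
    have "(poly p x, poly q x, poly r x) \<in> surface_U"
      using sub unfolding C p_def q_def r_def by blast
    then show "poly (T\<^sup>2 - (r\<^sup>2 + 3) * q\<^sup>2) x = poly [:1:] x"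
      by (simp add: surface_U_iff_pell T_def numeral_poly)
  qed
  have Ts: "poly T s = of_int (y - u * z)" by (simp add: T_def s)
  show False
  proof (cases "degree r = 0")
    case True
    then obtain k where "r = [:k:]" by (rule degree_eq_zeroE)
    with s have r: "r = [:of_int z:]" by simp
    \<comment> \<open>For constant \<open>r\<close> the number r^2 + 3 = z^2 + 3 is a nonzero square
      in the complex numbers. Then T - w q and T + w q are polynomials with product 1, hence
      constant, so the whole parametrization is constant.\<close>
    define w where "w = complex_of_real (sqrt (of_int (z\<^sup>2 + 3)))"
    have "sqrt (of_int (z\<^sup>2 + 3)) > 0" by (simp add: add_nonneg_pos)
    then have w0: "w \<noteq> 0" by (simp add: w_def)
    have "w * w = of_int (z\<^sup>2 + 3)"
      unfolding w_def by (subst of_real_mult[symmetric]) (simp add: real_sqrt_mult_self add_nonneg_nonneg)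
    then have ww: "r\<^sup>2 + 3 = [:w:] * [:w:]" by (simp add: r power2_eq_square numeral_poly)
    have fac: "(T - [:w:] * q) * (T + [:w:] * q) = [:1:]"
      unfolding eq[symmetric] ww by (simp add: algebra_simps power2_eq_square)
    then have nz: "T - [:w:] * q \<noteq> 0" "T + [:w:] * q \<noteq> 0" by force+
    have "degree (T - [:w:] * q) + degree (T + [:w:] * q) = degree ([:1:] :: complex poly)"
      unfolding fac[symmetric] using nz by (rule degree_mult_eq[symmetric])
    then have d0: "degree (T - [:w:] * q) = 0" "degree (T + [:w:] * q) = 0" by simp_all
    then obtain a b where ab: "T - [:w:] * q = [:a:]" "T + [:w:] * q = [:b:]"
      by (meson degree_eq_zeroE)
    have "smult (2 * w) q = [:b - a:]"
    proof -
      have "smult (2 * w) q = (T + [:w:] * q) - (T - [:w:] * q)"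
        using smult_add_left[of w w q] by simp
      then show ?thesis unfolding ab by simp
    qed
    then have "degree (smult (2 * w) q) = 0" by simp
    then have q: "degree q = 0" using w0 by simp
    then obtain k where "q = [:k:]" by (rule degree_eq_zeroE)
    have "p = [:a:] + [:w:] * q + q * r" unfolding ab(1)[symmetric] T_def by simp
    then have "degree p = 0" by (simp add: \<open>q = [:k:]\<close> r)
    with q True deg nonconst show False by simp
  next
    case False
    then obtain m a \<sigma> where sol: "\<sigma> = 1 \<or> \<sigma> = -1" "T = smult a (fst (norm3_pow r m))"
      "q = smult (\<sigma> * a) (snd (norm3_pow r m))"
      using polynomial_pell_solutions[OF eq] by blast
    define P where "P = fst (norm3_pow z m)"
    define Q where "Q = snd (norm3_pow z m)"
    have t: "of_int (y - u * z) = a * of_int P" and uQ: "of_int u = \<sigma> * a * of_int Q"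
      using Ts s(2) unfolding sol(2,3)
      by (simp_all add: poly_norm3_pow s(3) norm3_pow_of_int P_def Q_def)
    have norm: "P\<^sup>2 - (z\<^sup>2 + 3) * Q\<^sup>2 = (-3) ^ m" unfolding P_def Q_def by (rule norm3_pow_norm)
    have "(y, u, z) \<in> surface_U"
    proof -
      have "(of_int y, of_int u, of_int z) \<in> (surface_U :: (complex \<times> complex \<times> complex) set)"
        using mem sub by blast
      then have "of_int ((y - u * z)\<^sup>2 - (z\<^sup>2 + 3) * u\<^sup>2) = (of_int 1 :: complex)"
        by (simp add: surface_U_iff_pell)
      then show ?thesis unfolding surface_U_iff_pell by (simp only: of_int_eq_iff)
    qed
    then have pt: "(y - u * z)\<^sup>2 - (z\<^sup>2 + 3) * u\<^sup>2 = 1" by (simp add: surface_U_iff_pell)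
    \<comment> \<open>This eliminates the unknown complex scalar \<open>a\<close>: with t = y - u z
      = a P and u = \<sigma> a Q, t^2 (P^2 - (z^2 + 3) Q^2) = P^2 (t^2 - (z^2 + 3) u^2) = P^2. What
      remains is an identity between integers.\<close>
    have "of_int ((y - u * z)\<^sup>2 * (-3) ^ m) = (of_int (y - u * z))\<^sup>2 * (of_int ((-3) ^ m) :: complex)"
      by simp
    also have "\<dots> = (a\<^sup>2 * of_int (P\<^sup>2 - (z\<^sup>2 + 3) * Q\<^sup>2)) * (of_int P)\<^sup>2"
      unfolding t norm by (simp add: power_mult_distrib)
    also have "a\<^sup>2 * of_int (P\<^sup>2 - (z\<^sup>2 + 3) * Q\<^sup>2) = (a * of_int P)\<^sup>2 - of_int (z\<^sup>2 + 3) * (\<sigma> * a * of_int Q)\<^sup>2"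
      using sol(1) by (auto simp: power_mult_distrib algebra_simps)
    also have "\<dots> = of_int ((y - u * z)\<^sup>2 - (z\<^sup>2 + 3) * u\<^sup>2)"
      unfolding t[symmetric] uQ[symmetric] by simp
    also have "\<dots> = 1" unfolding pt by simp
    finally have "of_int ((y - u * z)\<^sup>2 * (-3) ^ m) = (of_int (P\<^sup>2) :: complex)" by simp
    then have key: "(y - u * z)\<^sup>2 * (-3) ^ m = P\<^sup>2" by (simp only: of_int_eq_iff)
    have "m = 0"
    proof (rule ccontr)
      assume "m \<noteq> 0"
      then have "(3::int) dvd (-3) ^ m" by (cases m) simp_all
      then have "3 dvd P\<^sup>2" unfolding key[symmetric] by simp
      moreover have "prime (3 :: int)" by simp
      ultimately have "3 dvd P" by (metis prime_dvd_power)
      with fst_norm3_pow_not_dvd_3[OF z3] show False by (simp add: P_def)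
    qed
    then have "Q = 0" by (simp add: Q_def)
    with uQ u show False by simp
  qed
qed

lemma mem_U_circ:
  assumes "(y, u, z) \<in> surface_U" "u \<noteq> 0" "\<not> 3 dvd z"
  shows "(y, u, z) \<in> U_circ"
  using assms mem_A1_curve_imp_dvd_3 by (auto simp: U_circ_def)

section \<open>Counting points and the density of exceptional z\<close>

text \<open>The counted points lie in a finite box. This matters because \<open>card\<close> of an
  infinite set is 0, so monotonicity of \<open>card\<close> calls for finiteness.\<close>

lemma card_le_N_U_circ:
  assumes inj: "inj_on f A" and sub: "f ` A \<subseteq> {(y, u, z) \<in> U_circ. real_of_int (Max {\<bar>y\<bar>, \<bar>u\<bar>, \<bar>z\<bar>}) \<le> B}"
  shows "card A \<le> N_U_circ B"
proof -
  let ?I = "{-\<lfloor>B\<rfloor>..\<lfloor>B\<rfloor>}"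
  have "\<bar>a\<bar> \<le> \<lfloor>B\<rfloor>" if "real_of_int (Max {\<bar>y\<bar>, \<bar>u\<bar>, \<bar>z\<bar>}) \<le> B" "a \<in> {y, u, z}" for a y u z :: int
  proof -
    have "\<bar>a\<bar> \<le> Max {\<bar>y\<bar>, \<bar>u\<bar>, \<bar>z\<bar>}" using that(2) by (intro Max_ge) auto
    also have "\<dots> \<le> \<lfloor>B\<rfloor>" using that(1) by (simp only: le_floor_iff)
    finally show ?thesis .
  qed
  then have "{(y, u, z) \<in> U_circ. real_of_int (Max {\<bar>y\<bar>, \<bar>u\<bar>, \<bar>z\<bar>}) \<le> B} \<subseteq> ?I \<times> ?I \<times> ?I"
    by (fastforce simp: abs_le_iff)
  then have "finite {(y, u, z) \<in> U_circ. real_of_int (Max {\<bar>y\<bar>, \<bar>u\<bar>, \<bar>z\<bar>}) \<le> B}"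
    by (rule finite_subset) auto
  from card_mono[OF this sub] show ?thesis
    by (simp add: card_image[OF inj] N_U_circ_def)
qed

text \<open>The largest coordinate of (t + u z, u, z) is t + u z, and z \<le> sqrt(z^2 + 3) bounds
  it by t + u sqrt(z^2 + 3), the fundamental unit.\<close>

lemma exists_U_circ_point:
  fixes z :: nat
  assumes z: "z > 0" "\<not> 3 dvd z" "squarefree (d_of z)"
  shows "\<exists>y u. (y, u, int z) \<in> U_circ \<and> real_of_int (Max {\<bar>y\<bar>, \<bar>u\<bar>, \<bar>int z\<bar>}) \<le> pell_eps (d_of z)
           \<and> pell_eps (d_of z) > 1"
proof -
  have irr: "sqrt (real (d_of z)) \<notin> \<rat>"
    using z by (intro sqrt_squarefree_irrational) (simp_all add: d_of_def)
  obtain t u where f: "is_fundamental_solution (d_of z) t u"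
    and e: "pell_eps (d_of z) = of_int t + of_int u * sqrt (real (d_of z))"
    using pell_eps_eq[OF irr] by blast
  have tu: "t \<ge> 1" "u \<ge> 1" "t\<^sup>2 - int (d_of z) * u\<^sup>2 = 1"
    using f by (auto simp: is_fundamental_solution_def)
  have "(t + u * int z, u, int z) \<in> surface_U"
    using tu(3) by (simp add: surface_U_iff_pell d_of_def)
  moreover have "\<not> 3 dvd int z" using z(2) by presburger
  ultimately have mem: "(t + u * int z, u, int z) \<in> U_circ"
    using tu(2) by (intro mem_U_circ) auto
  have "real z \<le> sqrt (real (d_of z))" by (rule real_le_rsqrt) (simp add: d_of_def)
  then have "of_int u * real z \<le> of_int u * sqrt (real (d_of z))"
    using tu(2) by (intro mult_left_mono) auto
  then have le: "real_of_int (t + u * int z) \<le> pell_eps (d_of z)" by (simp add: e)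
  define w where "w = u * int z"
  have "u \<le> w" "int z \<le> w" using tu(2) z(1) by (simp_all add: w_def)
  then have "Max {\<bar>t + w\<bar>, \<bar>u\<bar>, \<bar>int z\<bar>} = t + w"
    using tu(1,2) by (intro Max_eqI) auto
  then have "Max {\<bar>t + u * int z\<bar>, \<bar>u\<bar>, \<bar>int z\<bar>} = t + u * int z"
    by (simp only: w_def)
  with mem le fundamental_solution_greater_one[OF f irr] show ?thesis
    unfolding e by (intro exI[of _ "t + u * int z"] exI[of _ u]) (simp only: conj_assoc simp_thms)
qed

theorem theorem1p3:
  fixes \<epsilon> :: real
  assumes "browning_wilsch_U"
    and "\<epsilon> > 0"
  shows "\<exists>E. density_zero E \<and>
           (\<exists>c>0. \<forall>z::nat. z > 0 \<and> \<not> 3 dvd z \<and> squarefree (d_of z) \<and> z \<notin> E \<longrightarrow>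
              ln (pell_eps (d_of z)) \<ge> c * real (d_of z) powr (1 / 8 - \<epsilon>))"
proof -
  \<comment> \<open>The lower bound 1/16 keeps the exponent positive for large \<epsilon>, so that
    \<open>B\<close> tends to infinity; \<open>a\<close> < 1/8 makes 8 a < 1.\<close>
  define a where "a = max (1/8 - \<epsilon>) (1/16)"
  have a: "a > 0" "a < 1/8" "1/8 - \<epsilon> \<le> a" using assms(2) by (auto simp: a_def max_def)
  \<comment> \<open>The exceptional set is taken for the implied constant 1.\<close>
  define E where "E = {z. z > 0 \<and> \<not> 3 dvd z \<and> squarefree (d_of z) \<and>
      ln (pell_eps (d_of z)) < real (d_of z) powr (1/8 - \<epsilon>)}"
  define B where "B = (\<lambda>N :: nat. exp (((real N)\<^sup>2 + 3) powr a))"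
  have count: "card (E \<inter> {1..N}) \<le> N_U_circ (B N)" for N
  proof -
    have "\<exists>y u. (y, u, int z) \<in> U_circ \<and> real_of_int (Max {\<bar>y\<bar>, \<bar>u\<bar>, \<bar>int z\<bar>}) \<le> B N"
      if "z \<in> E \<inter> {1..N}" for z
    proof -
      have z: "z > 0" "\<not> 3 dvd z" "squarefree (d_of z)" "z \<le> N"
        "ln (pell_eps (d_of z)) < real (d_of z) powr (1/8 - \<epsilon>)"
        using that by (auto simp: E_def)
      obtain y u where yu: "(y, u, int z) \<in> U_circ"
        "real_of_int (Max {\<bar>y\<bar>, \<bar>u\<bar>, \<bar>int z\<bar>}) \<le> pell_eps (d_of z)" "pell_eps (d_of z) > 1"
        using exists_U_circ_point[OF z(1-3)] by blast
      have "real (d_of z) powr (1/8 - \<epsilon>) \<le> real (d_of z) powr a"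
        using a(3) by (intro powr_mono) (simp_all add: d_of_def)
      also have "\<dots> \<le> ((real N)\<^sup>2 + 3) powr a"
        using a(1) z(4) by (intro powr_mono2) (simp_all add: d_of_def power_mono)
      finally have "ln (pell_eps (d_of z)) \<le> ((real N)\<^sup>2 + 3) powr a" using z(5) by linarith
      then have "exp (ln (pell_eps (d_of z))) \<le> B N" by (simp add: B_def)
      then have "pell_eps (d_of z) \<le> B N" using yu(3) by simp
      with yu show ?thesis by (blast intro: order_trans)
    qed
    then obtain y u where yu: "\<And>z. z \<in> E \<inter> {1..N} \<Longrightarrow> (y z, u z, int z) \<in> U_circ \<and>
        real_of_int (Max {\<bar>y z\<bar>, \<bar>u z\<bar>, \<bar>int z\<bar>}) \<le> B N" by metis
    show ?thesis
    proof (rule card_le_N_U_circ)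
      show "inj_on (\<lambda>z. (y z, u z, int z)) (E \<inter> {1..N})" by (auto simp: inj_on_def)
      show "(\<lambda>z. (y z, u z, int z)) ` (E \<inter> {1..N})
        \<subseteq> {(y, u, z) \<in> U_circ. real_of_int (Max {\<bar>y\<bar>, \<bar>u\<bar>, \<bar>z\<bar>}) \<le> B N}"
        using yu by auto
    qed
  qed
  obtain c where c: "c > 0" "eventually (\<lambda>x. real (N_U_circ x) \<le> c * \<bar>ln x ^ 4\<bar>) at_top"
    using assms(1) by (auto simp: browning_wilsch_U_def elim!: landau_o.bigE)
  have "filterlim B at_top sequentially" unfolding B_def using a(1) by real_asymp
  from eventually_compose_filterlim[OF c(2) this]
  \<comment> \<open>ln (B N) is (N^2 + 3)^a, so its fourth power has order N^(8 a), which is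
    o(N).\<close>
  have ev: "eventually (\<lambda>N. real (card (E \<inter> {1..N})) / real N \<le> c * ((real N)\<^sup>2 + 3) powr (4 * a) / real N) sequentially"
  proof eventually_elim
    case (elim N)
    have "real (card (E \<inter> {1..N})) \<le> real (N_U_circ (B N))" using count by simp
    also have "\<dots> \<le> c * (((real N)\<^sup>2 + 3) powr a) ^ 4" using elim by (simp add: B_def)
    also have "(((real N)\<^sup>2 + 3) powr a) ^ 4 = ((real N)\<^sup>2 + 3) powr (4 * a)"
    proof -
      have "(real N)\<^sup>2 + 3 > 0" by (simp add: add_nonneg_pos)
      then have "(((real N)\<^sup>2 + 3) powr a) ^ 4 = (((real N)\<^sup>2 + 3) powr a) powr 4" by simp
      then show ?thesis by (simp add: powr_powr mult.commute)
    qed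
    finally show ?case by (intro divide_right_mono) simp_all
  qed
  have "(\<lambda>N. c * ((real N)\<^sup>2 + 3) powr (4 * a) / real N) \<longlonglongrightarrow> 0"
    using a by real_asymp
  then have "density_zero E" unfolding density_zero_def
    by (intro tendsto_sandwich[OF always_eventually ev tendsto_const]) simp_all
  moreover have "\<forall>z::nat. z > 0 \<and> \<not> 3 dvd z \<and> squarefree (d_of z) \<and> z \<notin> E \<longrightarrow>
      ln (pell_eps (d_of z)) \<ge> 1 * real (d_of z) powr (1 / 8 - \<epsilon>)"
    by (auto simp: E_def)
  ultimately show ?thesis using zero_less_one by blast
qed

end
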